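(* There are only finitely many squarefree integers $D\ge 2$ such that the real quadratic field $K=\mathbb{Q}(\sqrt{D})$ admits a binary or ternary $\mathbb{Z}$-universal generalized quadratic form.
   Context: $\mathcal{O}_K$ is the ring of integers of $K$ and $\tau: K\to K$, $a+b\sqrt{D}\mapsto a-b\sqrt{D}$. A generalized quadratic form in $n$ variables over $K$ is an expression $G(z_1,\dots,z_n)=\sum_{1\le i\le j\le n}\alpha_{ij}z_iz_j+\sum_{1\le i,j\le n}\beta_{ij}z_i\tau(z_j)+\sum_{1\le i\le j\le n}\gamma_{ij}\tau(z_i)\tau(z_j)$ with coefficients in $K$, evaluated at $\mathbf{a}\in K^n$ by substituting $a_i$ for $z_i$ and $\tau(a_i)$ for $\tau(z_i)$. Binary/ternary means $n=2$/$n=3$. $G$ is integral if all coefficients lie in $\mathcal{O}_K$; $\mathbb{Z}$-valued if $G(\mathbf{a})\in\mathbb{Z}$ for all $\mathbf{a}\in\mathcal{O}_K^n$; positive definite if $G(\mathbf{a})>0$ for all nonzero $\mathbf{a}\in K^n$; $\mathbb{Z}$-universal if positive definite, integral, $\mathbb{Z}$-valued, and every positive integer equals $G(\mathbf{a})$ for some $\mathbf{a}\in\mathcal{O}_K^n$. *)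

theory Defs
  imports "HOL-Analysis.Analysis" "HOL-Computational_Algebra.Computational_Algebra"
begin

text \<open>
  The real quadratic field \<open>\<rat>(\<surd>D)\<close> is realised as a subset of the reals, so that positivity
  of an element of \<open>K\<close> refers to the embedding with \<open>\<surd>D > 0\<close>.
\<close>

definition quad_field :: "int \<Rightarrow> real set" where
  "quad_field D = {a + b * sqrt (of_int D) | a b. a \<in> \<rat> \<and> b \<in> \<rat>}"

definition quad_int :: "int \<Rightarrow> real set" where
  "quad_int D = {x \<in> quad_field D. algebraic_int x}"

text \<open>
  The description is unique on \<open>quad_field D\<close> for squarefree \<open>D \<ge> 2\<close>, see \<open>quad_conj_eq\<close>
  below; elsewhere the value is irrelevant.
\<close>

definition quad_conj :: "int \<Rightarrow> real \<Rightarrow> real" where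
  "quad_conj D x = (THE y. \<exists>a\<in>\<rat>. \<exists>b\<in>\<rat>.
      x = a + b * sqrt (of_int D) \<and> y = a - b * sqrt (of_int D))"

lemma sqrt_squarefree_irrational:
  fixes D :: int
  assumes "D \<ge> 2" "squarefree D"
  shows "sqrt (of_int D) \<notin> \<rat>"
proof
  assume rat: "sqrt (of_int D) \<in> \<rat>"
  have "algebraic_int (sqrt (of_int D))"
  proof (rule algebraic_int.intros)
    let ?p = "[:- of_int D, 0, 1:] :: real poly"
    show "lead_coeff ?p = 1" by simp
    show "\<forall>i. coeff ?p i \<in> \<int>"
      by (auto simp: coeff_pCons split: nat.splits)
    show "poly ?p (sqrt (of_int D)) = 0" using assms by simp
  qed
  with rat have "sqrt (of_int D) \<in> \<int>" by (simp add: rational_algebraic_int_is_int)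
  then obtain k where "sqrt (of_int D) = of_int k" by (auto elim: Ints_cases)
  moreover have "of_int D = (sqrt (of_int D))\<^sup>2" using assms by simp
  ultimately have "(of_int D :: real) = of_int (k\<^sup>2)" by simp
  then have D: "D = k\<^sup>2" by (simp only: of_int_eq_iff)
  then have "k dvd 1" using assms by (auto simp: squarefree_def)
  then have "D = 1" using D by (auto simp: zdvd1_eq abs_if split: if_splits)
  with assms show False by simp
qed

lemma quad_conj_eq:
  fixes D :: int
  assumes "D \<ge> 2" "squarefree D" "a \<in> \<rat>" "b \<in> \<rat>"
  shows "quad_conj D (a + b * sqrt (of_int D)) = a - b * sqrt (of_int D)"
  unfolding quad_conj_def
proof (rule the_equality)
  let ?s = "sqrt (of_int D)"
  show "\<exists>a'\<in>\<rat>. \<exists>b'\<in>\<rat>. a + b * ?s = a' + b' * ?s \<and> a - b * ?s = a' - b' * ?s"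
    using assms by blast
  fix y
  assume "\<exists>a'\<in>\<rat>. \<exists>b'\<in>\<rat>. a + b * ?s = a' + b' * ?s \<and> y = a' - b' * ?s"
  then obtain a' b' where ab: "a' \<in> \<rat>" "b' \<in> \<rat>" "a + b * ?s = a' + b' * ?s" "y = a' - b' * ?s"
    by blast
  have "b = b'"
  proof (rule ccontr)
    assume "b \<noteq> b'"
    then have "?s = (a' - a) / (b - b')" using ab by (simp add: field_simps)
    moreover have "(a' - a) / (b - b') \<in> \<rat>" using ab assms by simp
    ultimately show False using sqrt_squarefree_irrational[OF assms(1,2)] by simp
  qed
  then show "y = a - b * ?s" using ab by simp
qed

text \<open>
  Coefficients and vectors are functions on the indices \<open>1, \<dots>, n\<close>; values at other indices
  (and at pairs \<open>i > j\<close> in the case of \<open>\<alpha>\<close> and \<open>\<gamma>\<close>) are never inspected.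
\<close>

record gen_quad_form =
  alpha :: "nat \<Rightarrow> nat \<Rightarrow> real"
  beta :: "nat \<Rightarrow> nat \<Rightarrow> real"
  gamma :: "nat \<Rightarrow> nat \<Rightarrow> real"

definition coeffs_in :: "nat \<Rightarrow> gen_quad_form \<Rightarrow> real set \<Rightarrow> bool" where
  "coeffs_in n G R \<longleftrightarrow>
     (\<forall>i\<in>{1..n}. \<forall>j\<in>{i..n}. alpha G i j \<in> R) \<and>
     (\<forall>i\<in>{1..n}. \<forall>j\<in>{1..n}. beta G i j \<in> R) \<and>
     (\<forall>i\<in>{1..n}. \<forall>j\<in>{i..n}. gamma G i j \<in> R)"

definition gqf_over :: "int \<Rightarrow> nat \<Rightarrow> gen_quad_form \<Rightarrow> bool" where
  "gqf_over D n G \<longleftrightarrow> coeffs_in n G (quad_field D)"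

definition gqf_eval :: "int \<Rightarrow> nat \<Rightarrow> gen_quad_form \<Rightarrow> (nat \<Rightarrow> real) \<Rightarrow> real" where
  "gqf_eval D n G a =
     (\<Sum>i=1..n. \<Sum>j=i..n. alpha G i j * a i * a j) +
     (\<Sum>i=1..n. \<Sum>j=1..n. beta G i j * a i * quad_conj D (a j)) +
     (\<Sum>i=1..n. \<Sum>j=i..n. gamma G i j * quad_conj D (a i) * quad_conj D (a j))"

definition gqf_integral :: "int \<Rightarrow> nat \<Rightarrow> gen_quad_form \<Rightarrow> bool" where
  "gqf_integral D n G \<longleftrightarrow> coeffs_in n G (quad_int D)"

definition gqf_Z_valued :: "int \<Rightarrow> nat \<Rightarrow> gen_quad_form \<Rightarrow> bool" where
  "gqf_Z_valued D n G \<longleftrightarrow> (\<forall>a \<in> {1..n} \<rightarrow> quad_int D. gqf_eval D n G a \<in> \<int>)"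

definition gqf_pos_def :: "int \<Rightarrow> nat \<Rightarrow> gen_quad_form \<Rightarrow> bool" where
  "gqf_pos_def D n G \<longleftrightarrow>
     (\<forall>a \<in> {1..n} \<rightarrow> quad_field D. (\<exists>i\<in>{1..n}. a i \<noteq> 0) \<longrightarrow> gqf_eval D n G a > 0)"

definition gqf_Z_universal :: "int \<Rightarrow> nat \<Rightarrow> gen_quad_form \<Rightarrow> bool" where
  "gqf_Z_universal D n G \<longleftrightarrow>
     gqf_pos_def D n G \<and> gqf_integral D n G \<and> gqf_Z_valued D n G \<and>
     (\<forall>m::int. m > 0 \<longrightarrow> (\<exists>a \<in> {1..n} \<rightarrow> quad_int D. gqf_eval D n G a = of_int m))"

end

theory Submission
  imports Defs
begin

text \<open>
  Modulo \<open>\<surd>D\<close> conjugation acts trivially, so the bilinear form attached to a \<open>\<int>\<close>-valued integral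
  generalized form in \<open>n\<close> variables, seen as a form of rank \<open>2n\<close> over \<open>\<int>\<close>, degenerates to rank at
  most \<open>n\<close> modulo \<open>D\<close>.  Let \<open>n \<le> 3\<close> and let four lattice vectors of bounded norm be given.  For large
  \<open>D\<close> there are more than \<open>D\<^sup>3\<close> integral combinations of them with coefficients at most a small
  multiple of \<open>D\<close>, so by pigeonhole some nontrivial one has inner products with all lattice vectors
  divisible by \<open>D\<close> up to a factor 8.  Its inner products with the four vectors are too small for
  that and hence vanish: any four short vectors are linearly dependent.

  So all short vectors span a space of dimension at most three, and it remains to see that such a
  space cannot represent all integers up to 115.  Vectors of norms 1, 2 and then 3 or 5 leave
  finitely many ternary forms \<open>x\<^sup>2 + b y\<^sup>2 + c z\<^sup>2\<close> over \<open>\<rat>\<close>, and each of them is anisotropic at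
  some prime, which prevents it from representing a suitable \<open>t \<le> 115\<close> even rationally.
\<close>

section \<open>Local obstructions for ternary diagonal forms\<close>

text \<open>Anisotropy of the quaternary form \<open>a x^2 + b y^2 + c z^2 - t w^2\<close>. Clearing
  denominators, it implies that the ternary form does not represent \<open>t\<close> even over the
  rationals.\<close>

definition only_trivial_zero :: "int \<Rightarrow> int \<Rightarrow> int \<Rightarrow> int \<Rightarrow> bool" where
  "only_trivial_zero a b c t \<longleftrightarrow>
     (\<forall>x y z w. a * x\<^sup>2 + b * y\<^sup>2 + c * z\<^sup>2 = t * w\<^sup>2 \<longrightarrow> x = 0 \<and> y = 0 \<and> z = 0 \<and> w = 0)"

text \<open>Infinite descent: dividing a nonzero solution by \<open>p\<close> gives another one with
  a smaller sum of absolute values.\<close>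

lemma only_trivial_zero_descent:
  fixes p :: int
  assumes p: "p \<ge> 2"
    and dvd: "\<And>x y z w. a * x\<^sup>2 + b * y\<^sup>2 + c * z\<^sup>2 = t * w\<^sup>2 \<Longrightarrow>
                p dvd x \<and> p dvd y \<and> p dvd z \<and> p dvd w"
  shows "only_trivial_zero a b c t"
  unfolding only_trivial_zero_def
proof (intro allI impI)
  fix x y z w
  assume "a * x\<^sup>2 + b * y\<^sup>2 + c * z\<^sup>2 = t * w\<^sup>2"
  then show "x = 0 \<and> y = 0 \<and> z = 0 \<and> w = 0"
  proof (induction "nat (\<bar>x\<bar> + \<bar>y\<bar> + \<bar>z\<bar> + \<bar>w\<bar>)" arbitrary: x y z w rule: less_induct)
    case less
    obtain x' y' z' w' where eq: "x = p * x'" "y = p * y'" "z = p * z'" "w = p * w'"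
      using dvd[OF less.prems] by (meson dvdE)
    have "p\<^sup>2 * (a * x'\<^sup>2 + b * y'\<^sup>2 + c * z'\<^sup>2) = p\<^sup>2 * (t * w'\<^sup>2)"
      using less.prems by (simp add: eq power_mult_distrib algebra_simps)
    then have sol: "a * x'\<^sup>2 + b * y'\<^sup>2 + c * z'\<^sup>2 = t * w'\<^sup>2" using p by simp
    let ?s' = "\<bar>x'\<bar> + \<bar>y'\<bar> + \<bar>z'\<bar> + \<bar>w'\<bar>"
    have s: "\<bar>x\<bar> + \<bar>y\<bar> + \<bar>z\<bar> + \<bar>w\<bar> = p * ?s'"
      using p by (simp add: eq abs_mult algebra_simps)
    show ?case
    proof (cases "?s' = 0")
      case True
      then show ?thesis by (auto simp: eq)
    next
      case False
      then have "?s' > 0" by linarith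
      then have "1 * ?s' < p * ?s'" using p by (intro mult_strict_right_mono) simp_all
      with \<open>?s' > 0\<close> have "nat ?s' < nat (\<bar>x\<bar> + \<bar>y\<bar> + \<bar>z\<bar> + \<bar>w\<bar>)"
        unfolding s nat_less_eq_zless[OF less_imp_le[OF \<open>?s' > 0\<close>]] by (simp only: mult_1)
      then have "x' = 0 \<and> y' = 0 \<and> z' = 0 \<and> w' = 0" using sol by (rule less.hyps)
      then show ?thesis by (simp add: eq)
    qed
  qed
qed

text \<open>The square is absorbed into the third variable, so that \<open>c\<close> matters only up
  to square factors.\<close>

lemma only_trivial_zero_scale:
  assumes "only_trivial_zero a b c t" "k \<noteq> 0"
  shows "only_trivial_zero a b (c * k\<^sup>2) t"
  unfolding only_trivial_zero_def
proof (intro allI impI)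
  fix x y z w
  assume "a * x\<^sup>2 + b * y\<^sup>2 + c * k\<^sup>2 * z\<^sup>2 = t * w\<^sup>2"
  then have "a * x\<^sup>2 + b * y\<^sup>2 + c * (k * z)\<^sup>2 = t * w\<^sup>2"
    by (simp add: power_mult_distrib mult.assoc)
  then have "x = 0 \<and> y = 0 \<and> k * z = 0 \<and> w = 0"
    using assms(1) unfolding only_trivial_zero_def by blast
  then show "x = 0 \<and> y = 0 \<and> z = 0 \<and> w = 0" using assms(2) by simp
qed

lemma only_trivial_zero_swap:
  "only_trivial_zero a b c t \<Longrightarrow> only_trivial_zero a c b t"
  unfolding only_trivial_zero_def
proof (intro allI impI)
  fix x y z w
  assume triv: "\<forall>x y z w. a * x\<^sup>2 + b * y\<^sup>2 + c * z\<^sup>2 = t * w\<^sup>2 \<longrightarrow> x = 0 \<and> y = 0 \<and> z = 0 \<and> w = 0"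
    and "a * x\<^sup>2 + c * y\<^sup>2 + b * z\<^sup>2 = t * w\<^sup>2"
  then have "a * x\<^sup>2 + b * z\<^sup>2 + c * y\<^sup>2 = t * w\<^sup>2" by simp
  with triv show "x = 0 \<and> y = 0 \<and> z = 0 \<and> w = 0" by blast
qed

section \<open>Executable criteria modulo p and modulo 16\<close>

definition anisotropic_mod :: "int \<Rightarrow> int \<Rightarrow> int \<Rightarrow> bool" where
  "anisotropic_mod p a b \<longleftrightarrow>
     list_all (\<lambda>x. list_all (\<lambda>y.
       (a * (x * x) + b * (y * y)) mod p = 0 \<longrightarrow> x = 0 \<and> y = 0) [0..p - 1]) [0..p - 1]"

lemma anisotropic_modD:
  assumes "anisotropic_mod p a b" "p > 0" "p dvd a * x\<^sup>2 + b * y\<^sup>2"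
  shows "p dvd x" "p dvd y"
proof -
  have "(a * (x mod p * (x mod p)) + b * (y mod p * (y mod p))) mod p = (a * x\<^sup>2 + b * y\<^sup>2) mod p"
    unfolding power2_eq_square by (intro mod_add_cong mod_mult_cong refl) simp_all
  also have "\<dots> = 0" using assms by simp
  finally have "(a * (x mod p * (x mod p)) + b * (y mod p * (y mod p))) mod p = 0" .
  moreover have "x mod p \<in> set [0..p - 1]" "y mod p \<in> set [0..p - 1]"
    using assms(2) pos_mod_bound[of p x] pos_mod_bound[of p y] by simp_all
  ultimately have "x mod p = 0 \<and> y mod p = 0"
    using assms(1) unfolding anisotropic_mod_def list_all_iff by (metis (no_types, lifting))
  then show "p dvd x" "p dvd y" by auto
qed

text \<open>The easy half of Springer's criterion: anisotropy of the first residue form makes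
  \<open>p\<close> divide \<open>x\<close> and \<open>y\<close>; after division of the equation by
  \<open>p\<close>, the second residue form does the same for \<open>z\<close> and
  \<open>w\<close>.\<close>

lemma only_trivial_zero_anisotropic_mod:
  fixes p :: int
  assumes "p \<ge> 2" and ab: "anisotropic_mod p a b" and cu: "anisotropic_mod p c (-u)"
  shows "only_trivial_zero a b (p * c) (p * u)"
proof (rule only_trivial_zero_descent)
  fix x y z w
  assume eq: "a * x\<^sup>2 + b * y\<^sup>2 + p * c * z\<^sup>2 = p * u * w\<^sup>2"
  then have "a * x\<^sup>2 + b * y\<^sup>2 = p * (u * w\<^sup>2 - c * z\<^sup>2)" by (simp add: algebra_simps)
  then have xy: "p dvd x" "p dvd y" using anisotropic_modD[OF ab, of x y] assms(1) by auto
  then obtain x' y' where "x = p * x'" "y = p * y'" by (meson dvdE)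
  with eq have "p * (c * z\<^sup>2 + (-u) * w\<^sup>2) = p * (p * - (a * x'\<^sup>2 + b * y'\<^sup>2))"
    by (simp add: algebra_simps power2_eq_square)
  then have "c * z\<^sup>2 + (-u) * w\<^sup>2 = p * - (a * x'\<^sup>2 + b * y'\<^sup>2)" using assms(1) by simp
  then have "p dvd z" "p dvd w" using anisotropic_modD[OF cu, of z w] assms(1) by auto
  with xy show "p dvd x \<and> p dvd y \<and> p dvd z \<and> p dvd w" by simp
qed (use assms in auto)

text \<open>The variables stand for squares modulo 16, which are 0, 1, 4 and 9; a square has the
  parity of its root.\<close>

definition all_even_mod_16 :: "int \<Rightarrow> int \<Rightarrow> int \<Rightarrow> int \<Rightarrow> bool" where
  "all_even_mod_16 a b c t \<longleftrightarrow>
     list_all (\<lambda>x. list_all (\<lambda>y. list_all (\<lambda>z. list_all (\<lambda>w.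
       (a * x + b * y + c * z - t * w) mod 16 = 0 \<longrightarrow> even x \<and> even y \<and> even z \<and> even w)
       [0, 1, 4, 9]) [0, 1, 4, 9]) [0, 1, 4, 9]) [0, 1, 4, 9]"

lemma square_mod_16: "(x::int)\<^sup>2 mod 16 \<in> set [0, 1, 4, 9]"
proof -
  have "x\<^sup>2 mod 16 = (x mod 16)\<^sup>2 mod 16" by (simp add: power_mod)
  moreover have "x mod 16 \<in> {0..15}" by simp
  then have "x mod 16 \<in> set [0..15]" by simp
  then have "(x mod 16)\<^sup>2 mod 16 \<in> set [0, 1, 4, 9]"
    by (simp add: upto_rec1) (elim disjE; simp)
  ultimately show ?thesis by simp
qed

lemma only_trivial_zero_mod_16:
  assumes "all_even_mod_16 a b c t"
  shows "only_trivial_zero a b c t"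
proof (rule only_trivial_zero_descent[where p = 2])
  fix x y z w :: int
  assume "a * x\<^sup>2 + b * y\<^sup>2 + c * z\<^sup>2 = t * w\<^sup>2"
  then have "(a * x\<^sup>2 + b * y\<^sup>2 + c * z\<^sup>2 - t * w\<^sup>2) mod 16 = 0" by simp
  also have "(a * x\<^sup>2 + b * y\<^sup>2 + c * z\<^sup>2 - t * w\<^sup>2) mod 16 =
      (a * (x\<^sup>2 mod 16) + b * (y\<^sup>2 mod 16) + c * (z\<^sup>2 mod 16) - t * (w\<^sup>2 mod 16)) mod 16"
    by (intro mod_diff_cong mod_add_cong mod_mult_cong refl) simp_all
  finally have "(a * (x\<^sup>2 mod 16) + b * (y\<^sup>2 mod 16) + c * (z\<^sup>2 mod 16) - t * (w\<^sup>2 mod 16)) mod 16 = 0" .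
  moreover have "even (v mod 16) \<longleftrightarrow> even v" for v :: int by presburger
  ultimately show "2 dvd x \<and> 2 dvd y \<and> 2 dvd z \<and> 2 dvd w"
    using assms square_mod_16[of x] square_mod_16[of y] square_mod_16[of z] square_mod_16[of w]
    unfolding all_even_mod_16_def list_all_iff by (metis even_power)
qed simp

section \<open>Tables of obstructed diagonal forms\<close>

definition obstructed :: "int \<Rightarrow> int \<Rightarrow> int \<Rightarrow> bool" where
  "obstructed a b c \<longleftrightarrow> (\<exists>t\<in>{1..115}. only_trivial_zero a b c t)"

lemma obstructed_anisotropic_mod:
  assumes "anisotropic_mod p a b" "anisotropic_mod p c' (-u)"
    and "p \<ge> 2" "1 \<le> p * u" "p * u \<le> 115" "k \<noteq> 0" "c = p * c' * k\<^sup>2"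
  shows "obstructed a b c"
  using only_trivial_zero_scale[OF only_trivial_zero_anisotropic_mod[OF assms(3,1,2)] assms(6)] assms(4,5,7)
  unfolding obstructed_def by auto

lemma obstructed_mod_16:
  assumes "all_even_mod_16 a b c' t" "1 \<le> t" "t \<le> 115" "k \<noteq> 0" "c = c' * k\<^sup>2"
  shows "obstructed a b c"
  using only_trivial_zero_scale[OF only_trivial_zero_mod_16[OF assms(1)] assms(4)] assms(2,3,5)
  unfolding obstructed_def by auto

text \<open>Meant for forms such as \<open>(1, 7, 49)\<close>, where the obstruction at 7 comes from
  the middle coefficient and the last one is a unit at 7 times a square.\<close>

lemma obstructed_swap_scale:
  assumes "obstructed a c' b" "k \<noteq> 0" "c = c' * k\<^sup>2"
  shows "obstructed a b c"
  using assms only_trivial_zero_swap only_trivial_zero_scale unfolding obstructed_def by metis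

text \<open>
  The values of \<open>c\<close> below are exactly the norms produced in \<open>escalator_norm_1_1\<close>, \<open>escalator_norm_1_2\<close>
  and \<open>escalator_norm_1_7\<close>; the prime in each step divides the squarefree part of \<open>c\<close> (or is 2 or 7).
\<close>

lemma obstructed_1_1:
  assumes "c \<in> {2, 3, 4, 7, 8, 10, 11, 12}"
  shows "obstructed 1 1 c"
proof -
  have "obstructed 1 1 2"
    by (rule obstructed_mod_16[where c' = 2 and t = 14 and k = 1]) code_simp+
  moreover
  have "obstructed 1 1 3"
    by (rule obstructed_anisotropic_mod[where p = 3 and c' = 1 and u = 2 and k = 1]) code_simp+
  moreover
  have "obstructed 1 1 4"
    by (rule obstructed_mod_16[where c' = 1 and t = 7 and k = 2]) code_simp+
  moreover
  have "obstructed 1 1 7"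
    by (rule obstructed_anisotropic_mod[where p = 7 and c' = 1 and u = 3 and k = 1]) code_simp+
  moreover
  have "obstructed 1 1 8"
    by (rule obstructed_mod_16[where c' = 2 and t = 14 and k = 2]) code_simp+
  moreover
  have "obstructed 1 1 10"
    by (rule obstructed_mod_16[where c' = 10 and t = 6 and k = 1]) code_simp+
  moreover
  have "obstructed 1 1 11"
    by (rule obstructed_anisotropic_mod[where p = 11 and c' = 1 and u = 2 and k = 1]) code_simp+
  moreover
  have "obstructed 1 1 12"
    by (rule obstructed_anisotropic_mod[where p = 3 and c' = 1 and u = 2 and k = 2]) code_simp+
  ultimately show ?thesis using assms by auto
qed

lemma obstructed_1_2:
  assumes "c \<in> {4, 8, 12, 14, 16, 26, 30, 32, 36, 42, 44, 46, 48, 56, 58, 62, 64, 68, 72, 74, 76, 78, 80}"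
  shows "obstructed 1 2 c"
proof -
  have "obstructed 1 2 4"
    by (rule obstructed_mod_16[where c' = 1 and t = 14 and k = 2]) code_simp+
  moreover
  have "obstructed 1 2 8"
    by (rule obstructed_mod_16[where c' = 2 and t = 7 and k = 2]) code_simp+
  moreover
  have "obstructed 1 2 12"
    by (rule obstructed_mod_16[where c' = 3 and t = 10 and k = 2]) code_simp+
  moreover
  have "obstructed 1 2 14"
    by (rule obstructed_anisotropic_mod[where p = 7 and c' = 2 and u = 3 and k = 1]) code_simp+
  moreover
  have "obstructed 1 2 16"
    by (rule obstructed_mod_16[where c' = 1 and t = 14 and k = 4]) code_simp+
  moreover
  have "obstructed 1 2 26"
    by (rule obstructed_anisotropic_mod[where p = 13 and c' = 2 and u = 1 and k = 1]) code_simp+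
  moreover
  have "obstructed 1 2 30"
    by (rule obstructed_anisotropic_mod[where p = 5 and c' = 6 and u = 2 and k = 1]) code_simp+
  moreover
  have "obstructed 1 2 32"
    by (rule obstructed_mod_16[where c' = 2 and t = 7 and k = 4]) code_simp+
  moreover
  have "obstructed 1 2 36"
    by (rule obstructed_mod_16[where c' = 1 and t = 14 and k = 6]) code_simp+
  moreover
  have "obstructed 1 2 42"
    by (rule obstructed_anisotropic_mod[where p = 7 and c' = 6 and u = 1 and k = 1]) code_simp+
  moreover
  have "obstructed 1 2 44"
    by (rule obstructed_mod_16[where c' = 11 and t = 10 and k = 2]) code_simp+
  moreover
  \<comment> \<open>Since 2 is a square modulo 23, \<open>u\<close> has to be a nonsquare, and the
    least one is 5. The resulting \<open>t = 23 * 5 = 115\<close> is the largest in the tables and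
    sets the range in \<open>obstructed\<close>.\<close>
  have "obstructed 1 2 46"
    by (rule obstructed_anisotropic_mod[where p = 23 and c' = 2 and u = 5 and k = 1]) code_simp+
  moreover
  have "obstructed 1 2 48"
    by (rule obstructed_mod_16[where c' = 3 and t = 10 and k = 4]) code_simp+
  moreover
  have "obstructed 1 2 56"
    by (rule obstructed_anisotropic_mod[where p = 7 and c' = 2 and u = 3 and k = 2]) code_simp+
  moreover
  have "obstructed 1 2 58"
    by (rule obstructed_anisotropic_mod[where p = 29 and c' = 2 and u = 1 and k = 1]) code_simp+
  moreover
  have "obstructed 1 2 62"
    by (rule obstructed_anisotropic_mod[where p = 31 and c' = 2 and u = 3 and k = 1]) code_simp+
  moreover
  have "obstructed 1 2 64"
    by (rule obstructed_mod_16[where c' = 1 and t = 14 and k = 8]) code_simp+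
  moreover
  have "obstructed 1 2 68"
    by (rule obstructed_mod_16[where c' = 17 and t = 14 and k = 2]) code_simp+
  moreover
  have "obstructed 1 2 72"
    by (rule obstructed_mod_16[where c' = 2 and t = 7 and k = 6]) code_simp+
  moreover
  have "obstructed 1 2 74"
    by (rule obstructed_anisotropic_mod[where p = 37 and c' = 2 and u = 1 and k = 1]) code_simp+
  moreover
  have "obstructed 1 2 76"
    by (rule obstructed_mod_16[where c' = 19 and t = 10 and k = 2]) code_simp+
  moreover
  have "obstructed 1 2 78"
    by (rule obstructed_anisotropic_mod[where p = 13 and c' = 6 and u = 1 and k = 1]) code_simp+
  moreover
  have "obstructed 1 2 80"
    by (rule obstructed_anisotropic_mod[where p = 5 and c' = 1 and u = 2 and k = 4]) code_simp+
  ultimately show ?thesis using assms by auto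
qed

lemma obstructed_1_7:
  assumes "c \<in> {21, 35, 49, 70, 84, 91, 98, 119, 133, 140, 147}"
  shows "obstructed 1 7 c"
proof -
  have "obstructed 1 7 21"
    by (rule obstructed_anisotropic_mod[where p = 3 and c' = 7 and u = 2 and k = 1]) code_simp+
  moreover
  have "obstructed 1 7 35"
    by (rule obstructed_anisotropic_mod[where p = 5 and c' = 7 and u = 1 and k = 1]) code_simp+
  moreover
  have "obstructed 1 7 49"
    by (rule obstructed_swap_scale[where c' = 1 and k = 7],
        rule obstructed_anisotropic_mod[where p = 7 and c' = 1 and u = 3 and k = 1]) code_simp+
  moreover
  have "obstructed 1 7 70"
    by (rule obstructed_anisotropic_mod[where p = 5 and c' = 14 and u = 2 and k = 1]) code_simp+
  moreover
  have "obstructed 1 7 84"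
    by (rule obstructed_anisotropic_mod[where p = 3 and c' = 7 and u = 2 and k = 2]) code_simp+
  moreover
  have "obstructed 1 7 91"
    by (rule obstructed_anisotropic_mod[where p = 13 and c' = 7 and u = 1 and k = 1]) code_simp+
  moreover
  have "obstructed 1 7 98"
    by (rule obstructed_swap_scale[where c' = 2 and k = 7],
        rule obstructed_anisotropic_mod[where p = 7 and c' = 1 and u = 3 and k = 1]) code_simp+
  moreover
  have "obstructed 1 7 119"
    by (rule obstructed_anisotropic_mod[where p = 17 and c' = 7 and u = 1 and k = 1]) code_simp+
  moreover
  have "obstructed 1 7 133"
    by (rule obstructed_anisotropic_mod[where p = 19 and c' = 7 and u = 2 and k = 1]) code_simp+
  moreover
  have "obstructed 1 7 140"
    by (rule obstructed_anisotropic_mod[where p = 5 and c' = 7 and u = 1 and k = 2]) code_simp+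
  moreover
  have "obstructed 1 7 147"
    by (rule obstructed_anisotropic_mod[where p = 3 and c' = 1 and u = 2 and k = 7]) code_simp+
  ultimately show ?thesis using assms by auto
qed

section \<open>Escalation in an integral lattice\<close>

lemma mem_upto_of_square_less:
  fixes p n :: int
  assumes "p\<^sup>2 < (n + 1)\<^sup>2" "n \<ge> 0"
  shows "p \<in> set [-n..n]"
  using abs_less_iff[of p "n + 1"] power2_less_imp_less[of "\<bar>p\<bar>" "n + 1"] assms by auto

text \<open>Zero is missing from the list because 12 is not a sum of two squares:
  \<open>x^2 + y^2\<close> does not represent 3 over the rationals.\<close>

lemma escalator_norm_1_1:
  fixes p q :: int
  assumes "12 - p\<^sup>2 - q\<^sup>2 \<ge> 0"
  shows "12 - p\<^sup>2 - q\<^sup>2 \<in> {2, 3, 4, 7, 8, 10, 11, 12}"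
proof -
  have "p\<^sup>2 < 16" "q\<^sup>2 < 16"
    using assms zero_le_power2[of p] zero_le_power2[of q] by linarith+
  then have "p \<in> set [-3..3]" "q \<in> set [-3..3]"
    by (intro mem_upto_of_square_less; simp)+
  then show ?thesis using assms by (simp add: upto_rec1 del: set_upto) (elim disjE; simp)
qed

text \<open>Zero is missing because \<open>x^2 + 2 y^2\<close> does not represent 5 over the
  rationals. It does represent 3, which is why 5 takes its place here.\<close>

lemma escalator_norm_1_2:
  fixes p q :: int
  assumes "40 - 2 * p\<^sup>2 - q\<^sup>2 \<ge> 0"
  shows "2 * (40 - 2 * p\<^sup>2 - q\<^sup>2) \<in>
    {4, 8, 12, 14, 16, 26, 30, 32, 36, 42, 44, 46, 48, 56, 58, 62, 64, 68, 72, 74, 76, 78, 80}"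
proof -
  have "p\<^sup>2 < 25" "q\<^sup>2 < 49"
    using assms zero_le_power2[of p] zero_le_power2[of q] by linarith+
  then have "p \<in> set [-4..4]" "q \<in> set [-6..6]"
    by (intro mem_upto_of_square_less; simp)+
  then show ?thesis using assms by (simp add: upto_rec1 del: set_upto) (elim disjE; simp)
qed

text \<open>Zero is missing because 3 is inert in the quadratic field of discriminant -7, so its
  norm form \<open>x^2 + x y + 2 y^2\<close> does not represent 3.\<close>

lemma escalator_norm_1_7:
  fixes p q :: int
  assumes "21 - 2 * p\<^sup>2 + p * q - q\<^sup>2 \<ge> 0"
  shows "7 * (21 - 2 * p\<^sup>2 + p * q - q\<^sup>2) \<in> {21, 35, 49, 70, 84, 91, 98, 119, 133, 140, 147}"
proof -
  \<comment> \<open>Four and eight times \<open>2 p^2 - p q + q^2\<close>, with the square completed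
    in \<open>q\<close> and in \<open>p\<close> respectively.\<close>
  have "7 * p\<^sup>2 + (p - 2 * q)\<^sup>2 \<le> 84" "7 * q\<^sup>2 + (4 * p - q)\<^sup>2 \<le> 168"
    using assms by (simp_all add: power2_eq_square algebra_simps)
  then have "p\<^sup>2 < 16" "q\<^sup>2 < 25"
    using zero_le_power2[of "p - 2 * q"] zero_le_power2[of "4 * p - q"] by linarith+
  then have "p \<in> set [-3..3]" "q \<in> set [-4..4]"
    by (intro mem_upto_of_square_less; simp)+
  then show ?thesis using assms by (simp add: upto_rec1 del: set_upto) (elim disjE; simp)
qed

section \<open>Lattices with an integral semidefinite form\<close>

definition int_comb :: "int \<Rightarrow> ('i \<Rightarrow> real) \<Rightarrow> int \<Rightarrow> ('i \<Rightarrow> real) \<Rightarrow> 'i \<Rightarrow> real" where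
  "int_comb x u y v = (\<lambda>i. of_int x * u i + of_int y * v i)"

text \<open>\<open>B\<close> models the polarization of an integer-valued quadratic form
  \<open>Q\<close>, so that \<open>B v v = 2 Q(v)\<close>; hence the factors 2 in the norms
  below.\<close>

locale int_form =
  fixes L :: "('i \<Rightarrow> real) set" and B :: "('i \<Rightarrow> real) \<Rightarrow> ('i \<Rightarrow> real) \<Rightarrow> int"
  assumes comb_mem [simp]: "u \<in> L \<Longrightarrow> v \<in> L \<Longrightarrow> int_comb x u y v \<in> L"
    and B_commute: "u \<in> L \<Longrightarrow> v \<in> L \<Longrightarrow> B u v = B v u"
    and B_comb_left [simp]: "u \<in> L \<Longrightarrow> v \<in> L \<Longrightarrow> w \<in> L \<Longrightarrow>
      B (int_comb x u y v) w = x * B u w + y * B v w"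
    and B_nonneg: "u \<in> L \<Longrightarrow> B u u \<ge> 0"
begin

lemma B_comb_right [simp]:
  "u \<in> L \<Longrightarrow> v \<in> L \<Longrightarrow> w \<in> L \<Longrightarrow> B w (int_comb x u y v) = x * B w u + y * B w v"
  using B_comb_left B_commute comb_mem by metis

text \<open>Singularity of the Gram matrix of any four short vectors, stated as an integral relation
  between its rows.\<close>

definition short_dependent :: "int \<Rightarrow> bool" where
  "short_dependent M \<longleftrightarrow>
     (\<forall>u1\<in>L. \<forall>u2\<in>L. \<forall>u3\<in>L. \<forall>u4\<in>L.
        B u1 u1 \<le> M \<and> B u2 u2 \<le> M \<and> B u3 u3 \<le> M \<and> B u4 u4 \<le> M \<longrightarrow>
        (\<exists>c1 c2 c3 c4. (c1, c2, c3, c4) \<noteq> (0, 0, 0, 0) \<and>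
           (\<forall>v\<in>{u1, u2, u3, u4}. c1 * B u1 v + c2 * B u2 v + c3 * B u3 v + c4 * B u4 v = 0)))"

text \<open>A vector \<open>v\<close> with \<open>B v v = 2 * t\<close> depends on the three
  orthogonal ones; comparing the norms of \<open>x u1 + y u2 + z u3\<close> and \<open>- w v\<close>
  gives a nontrivial zero of the quaternary form. The bound 150 leaves room for 147, the largest
  \<open>c\<close> in the tables.\<close>

lemma orthogonal_not_obstructed:
  assumes dep: "short_dependent 300"
    and univ: "\<And>m. m \<in> {1..115} \<Longrightarrow> \<exists>v\<in>L. B v v = 2 * m"
    and L: "u1 \<in> L" "u2 \<in> L" "u3 \<in> L"
    and norms: "B u1 u1 = 2 * a" "B u2 u2 = 2 * b" "B u3 u3 = 2 * c"
    and le: "a \<le> 150" "b \<le> 150" "c \<le> 150"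
    and orth: "B u1 u2 = 0" "B u1 u3 = 0" "B u2 u3 = 0"
  shows "\<not> obstructed a b c"
proof
  assume "obstructed a b c"
  then obtain t where t: "t \<in> {1..115}" "only_trivial_zero a b c t" unfolding obstructed_def by blast
  from univ[OF t(1)] obtain v where v: "v \<in> L" "B v v = 2 * t" by blast
  have "B u1 u1 \<le> 300 \<and> B u2 u2 \<le> 300 \<and> B u3 u3 \<le> 300 \<and> B v v \<le> 300"
    using v t(1) norms le by simp
  with dep L v(1) have "\<exists>c1 c2 c3 c4. (c1, c2, c3, c4) \<noteq> (0, 0, 0, 0) \<and>
      (\<forall>w\<in>{u1, u2, u3, v}. c1 * B u1 w + c2 * B u2 w + c3 * B u3 w + c4 * B v w = 0)"
    unfolding short_dependent_def by blast
  then obtain x y z w where nz: "(x, y, z, w) \<noteq> (0, 0, 0, 0)"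
    and rel: "\<And>s. s \<in> {u1, u2, u3, v} \<Longrightarrow> x * B u1 s + y * B u2 s + z * B u3 s + w * B v s = 0"
    by metis
  have orth': "B u2 u1 = 0" "B u3 u1 = 0" "B u3 u2 = 0"
    using orth L B_commute by metis+
  have com: "B v u1 = B u1 v" "B v u2 = B u2 v" "B v u3 = B u3 v"
    using L v B_commute by metis+
  have 1: "x * (2 * a) + w * B u1 v = 0" using rel[of u1] by (simp add: norms orth' com)
  have 2: "y * (2 * b) + w * B u2 v = 0" using rel[of u2] by (simp add: norms orth orth' com)
  have 3: "z * (2 * c) + w * B u3 v = 0" using rel[of u3] by (simp add: norms orth com)
  have 4: "x * B u1 v + y * B u2 v + z * B u3 v + w * (2 * t) = 0" using rel[of v] by (simp add: v)
  \<comment> \<open>The relations are weighted by \<open>x\<close>, \<open>y\<close>,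
    \<open>z\<close> and \<open>-w\<close> so that the products with \<open>v\<close>
    cancel.\<close>
  have "2 * (a * x\<^sup>2 + b * y\<^sup>2 + c * z\<^sup>2) - 2 * (t * w\<^sup>2) =
      x * (x * (2 * a) + w * B u1 v) + y * (y * (2 * b) + w * B u2 v) + z * (z * (2 * c) + w * B u3 v)
      - w * (x * B u1 v + y * B u2 v + z * B u3 v + w * (2 * t))"
    by (simp add: power2_eq_square algebra_simps)
  also have "\<dots> = 0" by (simp only: 1 2 3 4)
  finally have "a * x\<^sup>2 + b * y\<^sup>2 + c * z\<^sup>2 = t * w\<^sup>2" by simp
  with t(2) nz show False unfolding only_trivial_zero_def by blast
qed

text \<open>By Cauchy-Schwarz the inner product is at most 2 in absolute value. Changing the sign of
  \<open>v2\<close>, or adding or subtracting \<open>v1\<close>, leaves the binary forms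
  \<open>x^2 + y^2\<close>, \<open>x^2 + 2 y^2\<close> and \<open>x^2 + x y + 2 y^2\<close>.\<close>

lemma norm_two_reduction:
  assumes "v1 \<in> L" "v2 \<in> L" and n: "B v1 v1 = 2" "B v2 v2 = 4"
  obtains u where "u \<in> L" "B u u = 2" "B v1 u = 0"
  | u where "u \<in> L" "B u u = 4" "B v1 u = 0"
  | u where "u \<in> L" "B u u = 4" "B v1 u = 1"
proof -
  define a where "a = B v1 v2"
  have a': "B v2 v1 = a" using assms B_commute unfolding a_def by metis
  note [simp] = assms a_def[symmetric] a'
  \<comment> \<open>The right-hand side is \<open>16 - 2 a^2\<close>.\<close>
  have "0 \<le> B (int_comb 2 v2 (-a) v1) (int_comb 2 v2 (-a) v1)" by (intro B_nonneg) simp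
  then have "a\<^sup>2 < (2 + 1)\<^sup>2" by (simp add: power2_eq_square algebra_simps)
  then have "a \<in> set [-2..2]" by (rule mem_upto_of_square_less) simp
  then consider "a = 0" | "a = 1" | "a = -1" | "a = 2" | "a = -2" by (auto simp: upto_rec1 simp del: set_upto)
  then show thesis
  proof cases
    case 1 show thesis by (rule that(2)[of v2]) (use 1 in simp_all)
  next
    case 2 show thesis by (rule that(3)[of v2]) (use 2 in simp_all)
  next
    case 3 show thesis by (rule that(3)[of "int_comb (-1) v2 0 v1"]) (use 3 in simp_all)
  next
    case 4 show thesis by (rule that(1)[of "int_comb 1 v2 (-1) v1"]) (use 4 in simp_all)
  next
    case 5 show thesis by (rule that(1)[of "int_comb 1 v2 1 v1"]) (use 5 in simp_all)
  qed
qed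

text \<open>Each binary form left by \<open>norm_two_reduction\<close> misses 3 or 5 over the
  rationals. Projecting \<open>v3\<close> or \<open>v5\<close> away from the plane thus gives a
  third orthogonal vector of nonzero norm, and with it one of the tabulated ternary forms.\<close>

theorem short_dependent_not_universal:
  assumes dep: "short_dependent 300"
    and univ: "\<And>m. m \<in> {1..115} \<Longrightarrow> \<exists>v\<in>L. B v v = 2 * m"
  shows False
proof -
  obtain v1 where v1 [simp]: "v1 \<in> L" "B v1 v1 = 2" using univ[of 1] by auto
  obtain v2 where v2: "v2 \<in> L" "B v2 v2 = 4" using univ[of 2] by auto
  obtain v3 where v3 [simp]: "v3 \<in> L" "B v3 v3 = 6" using univ[of 3] by auto
  obtain v5 where v5 [simp]: "v5 \<in> L" "B v5 v5 = 10" using univ[of 5] by auto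
  from norm_two_reduction[OF v1(1) v2(1) v1(2) v2(2)] show False
  proof cases
    case (1 u)
    define p q where "p = B v1 v3" and "q = B u v3"
    define w where "w = int_comb 1 (int_comb 2 v3 (-p) v1) (-q) u"
    have [simp]: "B v3 v1 = p" "B v3 u = q" "B u v1 = 0"
      using B_commute 1 v1 v3 unfolding p_def q_def by metis+
    note [simp] = p_def[symmetric] q_def[symmetric] 1
    have w: "w \<in> L" "B w w = 2 * (12 - p\<^sup>2 - q\<^sup>2)" "B v1 w = 0" "B u w = 0"
      unfolding w_def by (simp_all add: power2_eq_square algebra_simps)
    have "12 - p\<^sup>2 - q\<^sup>2 \<in> {2, 3, 4, 7, 8, 10, 11, 12}"
      using B_nonneg[OF w(1)] w(2) by (intro escalator_norm_1_1) simp
    moreover have "\<not> obstructed 1 1 (12 - p\<^sup>2 - q\<^sup>2)"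
      by (rule orthogonal_not_obstructed[OF dep univ, of v1 u w]) (use w calculation in auto)
    ultimately show False using obstructed_1_1 by blast
  next
    case (2 u)
    define p q where "p = B v1 v5" and "q = B u v5"
    \<comment> \<open>The factor 4 clears the denominators in the projection
      \<open>(p/2) v1 + (q/4) u\<close> of \<open>v5\<close>.\<close>
    define w where "w = int_comb 1 (int_comb 4 v5 (-2 * p) v1) (-q) u"
    have [simp]: "B v5 v1 = p" "B v5 u = q" "B u v1 = 0"
      using B_commute 2 v1 v5 unfolding p_def q_def by metis+
    note [simp] = p_def[symmetric] q_def[symmetric] 2
    have w: "w \<in> L" "B w w = 2 * (2 * (40 - 2 * p\<^sup>2 - q\<^sup>2))" "B v1 w = 0" "B u w = 0"
      unfolding w_def by (simp_all add: power2_eq_square algebra_simps)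
    have "2 * (40 - 2 * p\<^sup>2 - q\<^sup>2) \<in>
        {4, 8, 12, 14, 16, 26, 30, 32, 36, 42, 44, 46, 48, 56, 58, 62, 64, 68, 72, 74, 76, 78, 80}"
      using B_nonneg[OF w(1)] w(2) by (intro escalator_norm_1_2) simp
    moreover have "\<not> obstructed 1 2 (2 * (40 - 2 * p\<^sup>2 - q\<^sup>2))"
      by (rule orthogonal_not_obstructed[OF dep univ, of v1 u w]) (use w calculation in auto)
    ultimately show False using obstructed_1_2 by blast
  next
    case (3 u)
    define p q where "p = B v1 v3" and "q = B u v3"
    \<comment> \<open>The coefficients come from the adjugate of the Gram matrix
      \<open>((2, 1), (1, 4))\<close> of \<open>v1\<close> and \<open>u\<close>, whose determinant
      is 7.\<close>
    define w where "w = int_comb 1 (int_comb 7 v3 (q - 4 * p) v1) (p - 2 * q) u"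
    \<comment> \<open>Orthogonalization of \<open>u\<close> against \<open>v1\<close>; the norm 14
      is the source of the coefficient 7.\<close>
    define u' where "u' = int_comb 2 u (-1) v1"
    have [simp]: "B v3 v1 = p" "B v3 u = q" "B u v1 = 1"
      using B_commute 3 v1 v3 unfolding p_def q_def by metis+
    note [simp] = p_def[symmetric] q_def[symmetric] 3
    have u': "u' \<in> L" "B u' u' = 14" "B v1 u' = 0" unfolding u'_def by simp_all
    have w: "w \<in> L" "B w w = 2 * (7 * (21 - 2 * p\<^sup>2 + p * q - q\<^sup>2))" "B v1 w = 0" "B u' w = 0"
      unfolding w_def u'_def by (simp_all add: power2_eq_square algebra_simps)
    have "7 * (21 - 2 * p\<^sup>2 + p * q - q\<^sup>2) \<in> {21, 35, 49, 70, 84, 91, 98, 119, 133, 140, 147}"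
      using B_nonneg[OF w(1)] w(2) by (intro escalator_norm_1_7) simp
    moreover have "\<not> obstructed 1 7 (7 * (21 - 2 * p\<^sup>2 + p * q - q\<^sup>2))"
      by (rule orthogonal_not_obstructed[OF dep univ, of v1 u' w]) (use w u' calculation in auto)
    ultimately show False using obstructed_1_7 by blast
  qed
qed

end

section \<open>Integers of real quadratic fields\<close>

lemma rat_sqrt_combination_eq_0:
  assumes "D \<ge> 2" "squarefree D" "a \<in> \<rat>" "b \<in> \<rat>" "a + b * sqrt (of_int D) = 0"
  shows "a = 0" "b = 0"
proof -
  show "b = 0"
  proof (rule ccontr)
    assume "b \<noteq> 0"
    then have "sqrt (of_int D) = - a / b" using assms(5) by (simp add: field_simps)
    then show False using sqrt_squarefree_irrational[OF assms(1,2)] assms(3,4) by simp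
  qed
  then show "a = 0" using assms(5) by simp
qed

text \<open>The square of the denominator is coprime to the numerator, hence divides
  \<open>D\<close>.\<close>

lemma squarefree_times_rat_square_int:
  fixes D :: int and q :: real
  assumes "squarefree D" "q \<in> \<rat>" "of_int D * q\<^sup>2 \<in> \<int>"
  shows "q \<in> \<int>"
proof -
  obtain m k :: nat where mk: "k \<noteq> 0" "\<bar>q\<bar> = m / k" "coprime m k"
    using Rats_abs_nat_div_natE[OF assms(2)] by metis
  obtain N where N: "of_int D * q\<^sup>2 = of_int N" using assms(3) by (auto elim: Ints_cases)
  have "q\<^sup>2 = (real m / real k)\<^sup>2" using mk(2) by (metis power2_abs)
  with N mk(1) have "of_int D * (real m)\<^sup>2 = of_int N * (real k)\<^sup>2"
    by (simp add: power_divide field_simps)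
  then have "real_of_int (D * (int m)\<^sup>2) = real_of_int (N * (int k)\<^sup>2)" by simp
  then have "D * (int m)\<^sup>2 = N * (int k)\<^sup>2" by (simp only: of_int_eq_iff)
  then have "(int k)\<^sup>2 dvd D * (int m)\<^sup>2" by simp
  moreover have "coprime ((int k)\<^sup>2) ((int m)\<^sup>2)" using mk(3) by (simp add: coprime_commute)
  ultimately have "(int k)\<^sup>2 dvd D" by (simp add: coprime_dvd_mult_left_iff)
  with assms(1) have "int k dvd 1" by (auto simp: squarefree_def)
  then have "\<bar>q\<bar> \<in> \<int>" using mk by simp
  then show ?thesis by (auto simp: abs_if split: if_splits)
qed

text \<open>
  Gauss's lemma: the primitive integral multiple of the minimal polynomial divides a monic integral
  polynomial, so its leading coefficient is a unit.
\<close>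

lemma quad_int_trace_norm:
  fixes D :: int and a b :: real
  assumes D: "D \<ge> 2" "squarefree D" and ab: "a \<in> \<rat>" "b \<in> \<rat>"
    and int: "algebraic_int (a + b * sqrt (of_int D))"
  shows "2 * a \<in> \<int> \<and> a\<^sup>2 - of_int D * b\<^sup>2 \<in> \<int>"
proof (cases "b = 0")
  case True
  then have "a \<in> \<int>" using int ab by (simp add: rational_algebraic_int_is_int)
  then show ?thesis using True by simp
next
  case False
  let ?s = "sqrt (of_int D)"
  define x n where "x = a + b * ?s" and "n = a\<^sup>2 - of_int D * b\<^sup>2"
  \<comment> \<open>As \<open>b\<close> is nonzero, 1 and \<open>x\<close> are independent over the
    rationals.\<close>
  have lin: "u = 0 \<and> v = 0" if "u \<in> \<rat>" "v \<in> \<rat>" "u + v * x = 0" for u v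
  proof -
    have "(u + v * a) + (v * b) * ?s = 0" using that(3) by (simp add: x_def algebra_simps)
    then have "u + v * a = 0" "v * b = 0"
      using rat_sqrt_combination_eq_0[OF D, of "u + v * a" "v * b"] that ab by simp_all
    with False show ?thesis by auto
  qed
  have x2: "x\<^sup>2 = 2 * a * x - n"
    using D by (simp add: x_def n_def power2_eq_square algebra_simps)
  have rat: "2 * a \<in> \<rat>" "n \<in> \<rat>" using ab by (simp_all add: n_def)
  then obtain m1 k1 m2 k2 :: int where k: "k1 \<noteq> 0" "k2 \<noteq> 0"
    "2 * a = of_int m1 / of_int k1" "n = of_int m2 / of_int k2"
    unfolding Rats_eq_int_div_int by auto
  \<comment> \<open>The polynomial \<open>X^2 - 2 a X + n\<close> with its denominators
    cleared.\<close>
  define g0 where "g0 = [:m2 * k1, - m1 * k2, k1 * k2:]"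
  define g where "g = primitive_part g0"
  have g0: "g0 \<noteq> 0" "degree g0 = 2" using k by (simp_all add: g0_def)
  have g: "content g = 1" "degree g = 2" "g \<noteq> 0"
    using g0 by (simp_all add: g_def)
  have "of_int m1 = 2 * a * of_int k1" "of_int m2 = n * of_int k2" using k by simp_all
  then have "poly (map_poly of_int g0) x = of_int (k1 * k2) * (n - 2 * a * x + x\<^sup>2)"
    by (simp add: g0_def map_poly_pCons power2_eq_square algebra_simps)
  also have "\<dots> = 0" by (simp add: x2)
  finally have "poly (map_poly of_int (smult (content g0) g)) x = 0" by (simp add: g_def)
  moreover have smult: "poly (map_poly of_int (smult c h)) x = of_int c * poly (map_poly of_int h) x" for c h
    by (simp add: map_poly_smult)
  ultimately have gx: "poly (map_poly of_int g) x = 0" using g0 by simp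
  obtain f where f: "poly (map_poly of_int f) x = 0" "lead_coeff f = 1"
    using int unfolding algebraic_int_altdef_ipoly x_def by blast
  obtain c q r where c: "c \<noteq> 0" "smult c f = g * q + r" and r: "r = 0 \<or> degree r < degree g"
    using pseudo_mod[OF g(3), of f] by blast
  have "poly (map_poly of_int (g * q + r)) x = of_int c * poly (map_poly of_int f) x"
    by (simp only: c(2)[symmetric] smult)
  moreover have "map_poly of_int (g * q + r) =
      map_poly of_int g * map_poly of_int q + (map_poly of_int r :: real poly)"
    by (rule poly_eqI) (simp add: coeff_map_poly coeff_mult)
  ultimately have rx: "poly (map_poly of_int r) x = 0" by (simp add: f gx)
  \<comment> \<open>A remainder of degree at most 1 that vanishes at \<open>x\<close> is zero by
    \<open>lin\<close>.\<close>
  have "degree r \<le> 1" using r g by auto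
  then have "r = [:coeff r 0, coeff r 1:]"
    by (intro poly_eqI) (auto simp: coeff_pCons coeff_eq_0 split: nat.splits)
  then obtain r0 r1 where r01: "r = [:r0, r1:]" by blast
  then have "of_int r0 + of_int r1 * x = 0" using rx by (simp add: map_poly_pCons mult.commute)
  then have "r = 0" using lin[of "of_int r0" "of_int r1"] r01 by simp
  then have fq: "smult c f = g * q" using c by simp
  \<comment> \<open>Comparing contents removes the factor \<open>c\<close> of the pseudo-division up
    to sign.\<close>
  have "content f = 1" using content_dvd_coeff[of f "degree f"] f(2) is_unit_content_iff by metis
  then have "content q = \<bar>c\<bar>" using arg_cong[OF fq, of content] g by (simp add: content_mult)
  then have "smult c f = smult \<bar>c\<bar> (g * primitive_part q)"
    using fq content_times_primitive_part[of q] by (metis mult_smult_right)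
  then have "c * lead_coeff f = \<bar>c\<bar> * (lead_coeff g * lead_coeff (primitive_part q))"
    by (metis lead_coeff_mult lead_coeff_smult)
  from arg_cong[OF this, of abs] have "\<bar>lead_coeff g * lead_coeff (primitive_part q)\<bar> = 1"
    using f(2) c(1) by (simp add: abs_mult)
  then have "lead_coeff g dvd 1" by (metis dvd_abs_iff dvd_triv_left)
  then have A: "\<bar>coeff g 2\<bar> = 1" using g by (simp add: zdvd1_eq)
  obtain u v w where uvw: "g = [:u, v, w:]"
    using g(2) by (metis degree2_coeffs)
  then have "of_int u + of_int v * x + of_int w * x\<^sup>2 = 0"
    using gx by (simp add: map_poly_pCons power2_eq_square algebra_simps)
  then have "(of_int u - of_int w * n) + (of_int v + of_int w * (2 * a)) * x = 0"
    unfolding x2 by (simp add: algebra_simps)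
  then have "of_int u - of_int w * n = 0 \<and> of_int v + of_int w * (2 * a) = 0"
    using rat by (intro lin) simp_all
  moreover have "w = 1 \<or> w = -1" using A uvw by (auto simp: numeral_2_eq_2)
  ultimately have "n = of_int u \<or> n = of_int (-u)" "2 * a = of_int v \<or> 2 * a = of_int (-v)" by auto
  then show ?thesis unfolding n_def[symmetric] by (metis Ints_of_int)
qed

text \<open>The congruence treats all residues of \<open>D\<close> modulo 4 at once. Here
  \<open>t\<close> is the trace, and \<open>D (2 b)^2 = t^2 - 4 n\<close> with integral norm
  \<open>n\<close> forces \<open>2 b\<close> to be an integer because \<open>D\<close> is
  squarefree.\<close>

lemma quad_int_iff:
  fixes D :: int
  assumes D: "D \<ge> 2" "squarefree D"
  shows "x \<in> quad_int D \<longleftrightarrow>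
    (\<exists>t y. 2 * x = of_int t + of_int y * sqrt (of_int D) \<and> 4 dvd t\<^sup>2 - D * y\<^sup>2)"
proof
  assume "x \<in> quad_int D"
  then obtain a b where ab: "a \<in> \<rat>" "b \<in> \<rat>" "x = a + b * sqrt (of_int D)" "algebraic_int x"
    by (auto simp: quad_int_def quad_field_def)
  from quad_int_trace_norm[OF D ab(1,2)] ab(3,4)
  obtain t n where t: "2 * a = of_int t" and n: "a\<^sup>2 - of_int D * b\<^sup>2 = of_int n"
    by (auto elim!: Ints_cases)
  have "of_int D * (2 * b)\<^sup>2 = (2 * a)\<^sup>2 - 4 * (a\<^sup>2 - of_int D * b\<^sup>2)"
    by (simp add: power2_eq_square algebra_simps)
  then have Db: "of_int D * (2 * b)\<^sup>2 = of_int (t\<^sup>2 - 4 * n)" unfolding t n by simp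
  then have "of_int D * (2 * b)\<^sup>2 \<in> \<int>" by (simp only: Ints_of_int)
  moreover have "2 * b \<in> \<rat>" using ab by simp
  ultimately have "2 * b \<in> \<int>" using squarefree_times_rat_square_int[OF D(2)] by blast
  then obtain y where y: "2 * b = of_int y" by (auto elim: Ints_cases)
  have "real_of_int (D * y\<^sup>2) = of_int (t\<^sup>2 - 4 * n)" using Db unfolding y by simp
  then have "D * y\<^sup>2 = t\<^sup>2 - 4 * n" by (simp only: of_int_eq_iff)
  then have "4 dvd t\<^sup>2 - D * y\<^sup>2" by simp
  moreover have "2 * x = of_int t + of_int y * sqrt (of_int D)"
    by (simp add: ab(3) t[symmetric] y[symmetric] algebra_simps)
  ultimately show "\<exists>t y. 2 * x = of_int t + of_int y * sqrt (of_int D) \<and> 4 dvd t\<^sup>2 - D * y\<^sup>2"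
    by blast
next
  assume "\<exists>t y. 2 * x = of_int t + of_int y * sqrt (of_int D) \<and> 4 dvd t\<^sup>2 - D * y\<^sup>2"
  then obtain t y n where x: "2 * x = of_int t + of_int y * sqrt (of_int D)" and n: "t\<^sup>2 - D * y\<^sup>2 = 4 * n"
    by (auto elim!: dvdE)
  have x': "x = of_int t / 2 + of_int y / 2 * sqrt (of_int D)" using x by simp
  have "(of_int t)\<^sup>2 - of_int D * (of_int y)\<^sup>2 = (4 * of_int n :: real)"
    using arg_cong[OF n, of real_of_int] by simp
  moreover have "(2 * x - of_int t)\<^sup>2 = of_int D * (of_int y)\<^sup>2" using D by (simp add: x power_mult_distrib)
  ultimately have "4 * (x\<^sup>2 - of_int t * x + of_int n) = 0"
    by (simp add: power2_eq_square algebra_simps)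
  then have root: "x\<^sup>2 - of_int t * x + of_int n = 0" by simp
  have "algebraic_int x"
  proof (rule algebraic_int.intros)
    let ?p = "[:of_int n, - of_int t, 1:] :: real poly"
    show "lead_coeff ?p = 1" by simp
    show "\<forall>i. coeff ?p i \<in> \<int>" by (auto simp: coeff_pCons split: nat.splits)
    show "poly ?p x = 0" using root by (simp add: power2_eq_square algebra_simps)
  qed
  moreover have "x \<in> quad_field D"
  proof -
    have "(of_int t / 2 :: real) \<in> \<rat>" "(of_int y / 2 :: real) \<in> \<rat>" by simp_all
    with x' show ?thesis unfolding quad_field_def by blast
  qed
  ultimately show "x \<in> quad_int D" by (simp add: quad_int_def)
qed

lemma quad_intE:
  assumes "D \<ge> 2" "squarefree D" "x \<in> quad_int D"
  obtains t y where "2 * x = of_int t + of_int y * sqrt (of_int D)" "4 dvd t\<^sup>2 - D * y\<^sup>2"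
    "2 * quad_conj D x = of_int t - of_int y * sqrt (of_int D)"
proof -
  obtain t y where x: "2 * x = of_int t + of_int y * sqrt (of_int D)" and ty: "4 dvd t\<^sup>2 - D * y\<^sup>2"
    using assms quad_int_iff by blast
  have "x = of_int t / 2 + of_int y / 2 * sqrt (of_int D)" using x by simp
  then have "quad_conj D x = of_int t / 2 - of_int y / 2 * sqrt (of_int D)"
    using quad_conj_eq[OF assms(1,2), of "of_int t / 2" "of_int y / 2"] by simp
  with x ty show thesis by (intro that) simp_all
qed

lemma quad_int_subset_field: "quad_int D \<subseteq> quad_field D"
  by (auto simp: quad_int_def)

lemma quad_int_combination:
  assumes D: "D \<ge> 2" "squarefree D" and uv: "u \<in> quad_int D" "v \<in> quad_int D"
  shows "of_int m * u + of_int n * v \<in> quad_int D"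
proof -
  obtain t y where u: "2 * u = of_int t + of_int y * sqrt (of_int D)" "4 dvd t\<^sup>2 - D * y\<^sup>2"
    using quad_intE[OF D uv(1)] by metis
  obtain t' y' where v: "2 * v = of_int t' + of_int y' * sqrt (of_int D)" "4 dvd t'\<^sup>2 - D * y'\<^sup>2"
    using quad_intE[OF D uv(2)] by metis
  have "even (t\<^sup>2 - D * y\<^sup>2)" "even (t'\<^sup>2 - D * y'\<^sup>2)"
    using u(2) v(2) dvd_trans[of 2 4] by fastforce+
  \<comment> \<open>Both \<open>t\<close> and \<open>D y\<close>, and likewise \<open>t'\<close> and
    \<open>D y'\<close>, have equal parity; this handles the cross term.\<close>
  then have "even (t * t' - D * (y * y'))" by auto
  then have "2 * 2 dvd 2 * (t * t' - D * (y * y'))" by (intro mult_dvd_mono) simp_all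
  then have even: "4 dvd 2 * (t * t' - D * (y * y'))" by simp
  have "4 dvd m\<^sup>2 * (t\<^sup>2 - D * y\<^sup>2) + n\<^sup>2 * (t'\<^sup>2 - D * y'\<^sup>2) + (m * n) * (2 * (t * t' - D * (y * y')))"
    by (rule dvd_add[OF dvd_add[OF dvd_mult[OF u(2)] dvd_mult[OF v(2)]] dvd_mult[OF even]])
  also have "\<dots> = (m * t + n * t')\<^sup>2 - D * (m * y + n * y')\<^sup>2"
    by (simp add: power2_eq_square algebra_simps)
  finally have "4 dvd (m * t + n * t')\<^sup>2 - D * (m * y + n * y')\<^sup>2" .
  moreover have "2 * (of_int m * u + of_int n * v) = of_int m * (2 * u) + of_int n * (2 * v)"
    by (simp add: algebra_simps)
  then have "2 * (of_int m * u + of_int n * v) =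
      of_int (m * t + n * t') + of_int (m * y + n * y') * sqrt (of_int D)"
    unfolding u v by (simp add: algebra_simps)
  ultimately show ?thesis unfolding quad_int_iff[OF D] by blast
qed

lemma quad_conj_combination:
  assumes D: "D \<ge> 2" "squarefree D" and uv: "u \<in> quad_field D" "v \<in> quad_field D"
  shows "quad_conj D (of_int m * u + of_int n * v) = of_int m * quad_conj D u + of_int n * quad_conj D v"
proof -
  obtain a b where u: "a \<in> \<rat>" "b \<in> \<rat>" "u = a + b * sqrt (of_int D)" using uv by (auto simp: quad_field_def)
  obtain c d where v: "c \<in> \<rat>" "d \<in> \<rat>" "v = c + d * sqrt (of_int D)" using uv by (auto simp: quad_field_def)
  have "of_int m * u + of_int n * v =
      (of_int m * a + of_int n * c) + (of_int m * b + of_int n * d) * sqrt (of_int D)"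
    unfolding u v by (simp add: algebra_simps)
  then have "quad_conj D (of_int m * u + of_int n * v) =
      (of_int m * a + of_int n * c) - (of_int m * b + of_int n * d) * sqrt (of_int D)"
    using u v quad_conj_eq[OF D, of "of_int m * a + of_int n * c" "of_int m * b + of_int n * d"] by simp
  also have "\<dots> = of_int m * quad_conj D u + of_int n * quad_conj D v"
    using u v by (simp add: quad_conj_eq[OF D] algebra_simps)
  finally show ?thesis .
qed

text \<open>The floor only changes the type: on \<open>quad_int D\<close> the sum is already an
  integer.\<close>

definition quad_trace :: "int \<Rightarrow> real \<Rightarrow> int" where
  "quad_trace D x = \<lfloor>x + quad_conj D x\<rfloor>"

lemma quad_trace_eq:
  assumes "D \<ge> 2" "squarefree D" "x \<in> quad_int D"
  shows "of_int (quad_trace D x) = x + quad_conj D x"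
proof -
  obtain t y where "2 * x = of_int t + of_int y * sqrt (of_int D)"
    "2 * quad_conj D x = of_int t - of_int y * sqrt (of_int D)"
    using quad_intE[OF assms] by metis
  then have "x + quad_conj D x = of_int t" by simp
  then show ?thesis by (simp add: quad_trace_def)
qed

lemma quad_trace_combination:
  assumes D: "D \<ge> 2" "squarefree D" and "u \<in> quad_int D" "v \<in> quad_int D"
  shows "quad_trace D (of_int m * u + of_int n * v) = m * quad_trace D u + n * quad_trace D v"
proof -
  have "u \<in> quad_field D" "v \<in> quad_field D" using assms by (auto simp: quad_int_def)
  then have "real_of_int (quad_trace D (of_int m * u + of_int n * v)) =
      of_int (m * quad_trace D u + n * quad_trace D v)"
    using assms
    by (simp add: quad_trace_eq quad_int_combination quad_conj_combination) (simp add: algebra_simps)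
  then show ?thesis by (simp only: of_int_eq_iff)
qed

section \<open>The order Z[sqrt D] and the ideal generated by sqrt D\<close>

definition sqrt_order :: "int \<Rightarrow> real set" where
  "sqrt_order D = {of_int a + of_int b * sqrt (of_int D) | a b. True}"

text \<open>The multiples of the root in \<open>sqrt_order D\<close>, as
  \<open>D a + b sqrt D = sqrt D (b + a sqrt D)\<close>.\<close>

definition sqrt_ideal :: "int \<Rightarrow> real set" where
  "sqrt_ideal D = {of_int (D * a) + of_int b * sqrt (of_int D) | a b. True}"

lemma two_times_quad_int:
  assumes "D \<ge> 2" "squarefree D" "x \<in> quad_int D"
  shows "2 * x \<in> sqrt_order D" "2 * quad_conj D x \<in> sqrt_order D"
proof -
  obtain t y where "2 * x = of_int t + of_int y * sqrt (of_int D)"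
    "2 * quad_conj D x = of_int t - of_int y * sqrt (of_int D)"
    using quad_intE[OF assms] by metis
  then have "2 * x = of_int t + of_int y * sqrt (of_int D)"
    "2 * quad_conj D x = of_int t + of_int (-y) * sqrt (of_int D)" by simp_all
  then show "2 * x \<in> sqrt_order D" "2 * quad_conj D x \<in> sqrt_order D"
    unfolding sqrt_order_def by blast+
qed

text \<open>Both \<open>2 * x\<close> and its conjugate are congruent to the trace modulo the root
  of \<open>D\<close>. One condition modulo \<open>D\<close> per coordinate thus controls
  \<open>x\<close> and its conjugate together, which is where the rank drops from \<open>2n\<close>
  to \<open>n\<close>.\<close>

lemma two_times_quad_int_ideal:
  assumes D: "D \<ge> 2" "squarefree D" "x \<in> quad_int D" and dvd: "D dvd quad_trace D x"
  shows "2 * x \<in> sqrt_ideal D" "2 * quad_conj D x \<in> sqrt_ideal D"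
proof -
  obtain t y where ty: "2 * x = of_int t + of_int y * sqrt (of_int D)"
    "2 * quad_conj D x = of_int t - of_int y * sqrt (of_int D)"
    using quad_intE[OF D] by metis
  then have "real_of_int (quad_trace D x) = of_int t" unfolding quad_trace_eq[OF D] by simp
  with dvd obtain a where "t = D * a" by (auto elim: dvdE)
  with ty have "2 * x = of_int (D * a) + of_int y * sqrt (of_int D)"
    "2 * quad_conj D x = of_int (D * a) + of_int (-y) * sqrt (of_int D)" by simp_all
  then show "2 * x \<in> sqrt_ideal D" "2 * quad_conj D x \<in> sqrt_ideal D"
    unfolding sqrt_ideal_def by blast+
qed

lemma sqrt_ideal_0: "0 \<in> sqrt_ideal D"
  unfolding sqrt_ideal_def by (auto intro!: exI[of _ 0])

lemma sqrt_ideal_add: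
  assumes "x \<in> sqrt_ideal D" "y \<in> sqrt_ideal D"
  shows "x + y \<in> sqrt_ideal D"
proof -
  from assms obtain a b c d where "x = of_int (D * a) + of_int b * sqrt (of_int D)"
    "y = of_int (D * c) + of_int d * sqrt (of_int D)" unfolding sqrt_ideal_def by blast
  then have "x + y = of_int (D * (a + c)) + of_int (b + d) * sqrt (of_int D)"
    by (simp add: algebra_simps)
  then show ?thesis unfolding sqrt_ideal_def by blast
qed

lemma sqrt_ideal_mult:
  assumes "D \<ge> 0" "x \<in> sqrt_order D" "y \<in> sqrt_ideal D"
  shows "x * y \<in> sqrt_ideal D"
proof -
  from assms obtain a b c d where "x = of_int a + of_int b * sqrt (of_int D)"
    "y = of_int (D * c) + of_int d * sqrt (of_int D)" unfolding sqrt_ideal_def sqrt_order_def by blast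
  moreover have "sqrt (of_int D) * sqrt (of_int D) = of_int D" using assms by simp
  then have "sqrt (of_int D) * (sqrt (of_int D) * z) = of_int D * z" for z by (metis mult.assoc)
  ultimately have "x * y = of_int (D * (a * c + b * d)) + of_int (a * d + b * D * c) * sqrt (of_int D)"
    using assms(1) by (simp add: algebra_simps)
  then show ?thesis unfolding sqrt_ideal_def by blast
qed

lemma sqrt_ideal_sum:
  "(\<And>i. i \<in> I \<Longrightarrow> f i \<in> sqrt_ideal D) \<Longrightarrow> sum f I \<in> sqrt_ideal D"
  by (induction I rule: infinite_finite_induct) (auto intro: sqrt_ideal_0 sqrt_ideal_add)

lemma int_in_sqrt_ideal:
  assumes "D \<ge> 2" "squarefree D" "of_int k \<in> sqrt_ideal D"
  shows "D dvd k"
proof -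
  from assms(3) obtain a b where "of_int k = of_int (D * a) + of_int b * sqrt (of_int D)"
    unfolding sqrt_ideal_def by blast
  then have "of_int (D * a - k) + of_int b * sqrt (of_int D) = 0" by simp
  then have "real_of_int (D * a - k) = 0"
    using rat_sqrt_combination_eq_0(1)[OF assms(1,2), of "of_int (D * a - k)" "of_int b"] by simp
  then have "D * a - k = 0" by (simp only: of_int_eq_0_iff)
  then show ?thesis by (metis dvd_triv_left eq_iff_diff_eq_0)
qed

text \<open>Two of the \<open>(C + 1)^4\<close> coefficient tuples with entries in
  \<open>0..C\<close> give the same residues; their difference is the required tuple.\<close>

lemma four_combinations_pigeonhole:
  fixes D :: int and t1 t2 t3 t4 :: "nat \<Rightarrow> int"
  assumes "D > 0" "C \<ge> 0" and card: "D ^ n < (C + 1) ^ 4"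
  obtains c1 c2 c3 c4 where "(c1, c2, c3, c4) \<noteq> (0, 0, 0, 0)"
    "\<bar>c1\<bar> \<le> C" "\<bar>c2\<bar> \<le> C" "\<bar>c3\<bar> \<le> C" "\<bar>c4\<bar> \<le> C"
    "\<forall>k\<in>{1..n}. D dvd c1 * t1 k + c2 * t2 k + c3 * t3 k + c4 * t4 k"
proof -
  define S where "S = {0..C} \<times> {0..C} \<times> {0..C} \<times> {0..C}"
  \<comment> \<open>Restriction to \<open>{1..n}\<close> places the values in a set of exactly
    \<open>D^n\<close> functions.\<close>
  define F where "F = (\<lambda>(c1, c2, c3, c4). \<lambda>k\<in>{1..n}. (c1 * t1 k + c2 * t2 k + c3 * t3 k + c4 * t4 k) mod D)"
  have "F ` S \<subseteq> (\<Pi>\<^sub>E k\<in>{1..n}. {0..<D})" using assms(1) by (auto simp: F_def)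
  then have "card (F ` S) \<le> card (\<Pi>\<^sub>E k\<in>{1..n}. {0..<D})"
    by (intro card_mono finite_PiE) simp_all
  also have "\<dots> = nat (D ^ n)" using assms(1) by (simp add: card_PiE nat_power_eq)
  also have "\<dots> < nat ((C + 1) ^ 4)" using card assms by simp
  also have "\<dots> = card S"
    using assms(2) by (simp add: S_def card_cartesian_product nat_mult_distrib power4_eq_xxxx mult.assoc)
  finally have "\<not> inj_on F S" by (rule pigeonhole)
  then obtain p p' where pp': "p \<in> S" "p' \<in> S" "F p = F p'" "p \<noteq> p'" unfolding inj_on_def by blast
  obtain a1 a2 a3 a4 where p: "p = (a1, a2, a3, a4)" by (metis prod_cases4)
  obtain b1 b2 b3 b4 where p': "p' = (b1, b2, b3, b4)" by (metis prod_cases4)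
  show thesis
  proof
    show "(a1 - b1, a2 - b2, a3 - b3, a4 - b4) \<noteq> (0, 0, 0, 0)" using pp'(4) by (simp add: p p')
    show "\<bar>a1 - b1\<bar> \<le> C" "\<bar>a2 - b2\<bar> \<le> C" "\<bar>a3 - b3\<bar> \<le> C" "\<bar>a4 - b4\<bar> \<le> C"
      using pp'(1,2) by (auto simp: S_def p p')
    show "\<forall>k\<in>{1..n}. D dvd (a1 - b1) * t1 k + (a2 - b2) * t2 k + (a3 - b3) * t3 k + (a4 - b4) * t4 k"
    proof
      fix k assume "k \<in> {1..n}"
      then have "(a1 * t1 k + a2 * t2 k + a3 * t3 k + a4 * t4 k) mod D =
          (b1 * t1 k + b2 * t2 k + b3 * t3 k + b4 * t4 k) mod D"
        using fun_cong[OF pp'(3), of k] by (simp add: F_def p p')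
      then have "D dvd (a1 * t1 k + a2 * t2 k + a3 * t3 k + a4 * t4 k) -
          (b1 * t1 k + b2 * t2 k + b3 * t3 k + b4 * t4 k)" by (simp add: mod_eq_dvd_iff)
      then show "D dvd (a1 - b1) * t1 k + (a2 - b2) * t2 k + (a3 - b3) * t3 k + (a4 - b4) * t4 k"
        by (simp add: algebra_simps)
    qed
  qed
qed

section \<open>Short vectors of a generalized form\<close>

text \<open>The conjugate vectors are separate arguments, so symmetry and bilinearity become
  identities that do not mention conjugation.\<close>

definition polar_form :: "nat \<Rightarrow> gen_quad_form \<Rightarrow> (nat \<Rightarrow> real) \<Rightarrow> (nat \<Rightarrow> real) \<Rightarrow>
    (nat \<Rightarrow> real) \<Rightarrow> (nat \<Rightarrow> real) \<Rightarrow> real" where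
  "polar_form n G a a' b b' =
     (\<Sum>i=1..n. \<Sum>j=i..n. alpha G i j * (a i * b j + a j * b i)) +
     (\<Sum>i=1..n. \<Sum>j=1..n. beta G i j * (a i * b' j + b i * a' j)) +
     (\<Sum>i=1..n. \<Sum>j=i..n. gamma G i j * (a' i * b' j + a' j * b' i))"

lemma polar_form_commute: "polar_form n G a a' b b' = polar_form n G b b' a a'"
  by (simp add: polar_form_def algebra_simps)

lemma polar_form_cong:
  assumes "\<And>i. i \<in> {1..n} \<Longrightarrow> a i = c i" "\<And>i. i \<in> {1..n} \<Longrightarrow> a' i = c' i"
  shows "polar_form n G a a' b b' = polar_form n G c c' b b'"
  unfolding polar_form_def using assms by (intro arg_cong2[where f = "(+)"] sum.cong refl) simp_all

lemma polar_form_combination: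
  "polar_form n G (\<lambda>i. x * a i + y * c i) (\<lambda>i. x * a' i + y * c' i) b b' =
     x * polar_form n G a a' b b' + y * polar_form n G c c' b b'"
  by (simp add: polar_form_def sum_distrib_left sum.distrib algebra_simps)

lemma polar_form_self: "polar_form n G a (\<lambda>i. quad_conj D (a i)) a (\<lambda>i. quad_conj D (a i)) = 2 * gqf_eval D n G a"
  by (simp add: polar_form_def gqf_eval_def sum_distrib_left algebra_simps)

text \<open>The factor 8 supplies one 2 for the coefficient and one for each of the two vector
  entries in every product; each product then has a factor in the ideal.\<close>

lemma polar_form_in_ideal:
  assumes "D \<ge> 0"
    and G: "\<And>i j. i \<in> {1..n} \<Longrightarrow> j \<in> {i..n} \<Longrightarrow> 2 * alpha G i j \<in> sqrt_order D"
      "\<And>i j. i \<in> {1..n} \<Longrightarrow> j \<in> {1..n} \<Longrightarrow> 2 * beta G i j \<in> sqrt_order D"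
      "\<And>i j. i \<in> {1..n} \<Longrightarrow> j \<in> {i..n} \<Longrightarrow> 2 * gamma G i j \<in> sqrt_order D"
    and a: "\<And>i. i \<in> {1..n} \<Longrightarrow> 2 * a i \<in> sqrt_ideal D" "\<And>i. i \<in> {1..n} \<Longrightarrow> 2 * a' i \<in> sqrt_ideal D"
    and b: "\<And>i. i \<in> {1..n} \<Longrightarrow> 2 * b i \<in> sqrt_order D" "\<And>i. i \<in> {1..n} \<Longrightarrow> 2 * b' i \<in> sqrt_order D"
  shows "8 * polar_form n G a a' b b' \<in> sqrt_ideal D"
proof -
  have summand: "x * (y * z + y' * z') \<in> sqrt_ideal D"
    if "x \<in> sqrt_order D" "y \<in> sqrt_order D" "z \<in> sqrt_ideal D" "y' \<in> sqrt_order D" "z' \<in> sqrt_ideal D"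
    for x y z y' z'
    using that \<open>D \<ge> 0\<close> by (intro sqrt_ideal_mult sqrt_ideal_add)
  have "8 * polar_form n G a a' b b' =
     (\<Sum>i=1..n. \<Sum>j=i..n. (2 * alpha G i j) * ((2 * b j) * (2 * a i) + (2 * b i) * (2 * a j))) +
     (\<Sum>i=1..n. \<Sum>j=1..n. (2 * beta G i j) * ((2 * b' j) * (2 * a i) + (2 * b i) * (2 * a' j))) +
     (\<Sum>i=1..n. \<Sum>j=i..n. (2 * gamma G i j) * ((2 * b' j) * (2 * a' i) + (2 * b' i) * (2 * a' j)))"
    by (simp add: polar_form_def sum_distrib_left algebra_simps)
  also have "\<dots> \<in> sqrt_ideal D"
    by (rule sqrt_ideal_add sqrt_ideal_sum summand G a b | simp)+
  finally show ?thesis .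
qed

section \<open>Choice of constants and the bound on D\<close>

lemma exists_pigeonhole_bound:
  fixes D K :: int
  assumes "K > 0" "D > K ^ 4" "n \<le> 3"
  obtains C where "C \<ge> 0" "K * C < D" "D ^ n < (C + 1) ^ 4"
proof
  \<comment> \<open>The largest \<open>C\<close> with \<open>K * C < D\<close>. It satisfies
    \<open>C + 1 >= D / K\<close>, so \<open>(C + 1)^4 >= D^4 / K^4 > D^3\<close>.\<close>
  let ?C = "(D - 1) div K"
  have D: "D > 1" using assms(1,2) zero_less_power[of K 4] by linarith
  show "?C \<ge> 0" using D assms(1) by (simp add: pos_imp_zdiv_nonneg_iff)
  have eq: "K * ?C + (D - 1) mod K = D - 1" by simp
  show "K * ?C < D" using eq pos_mod_sign[OF assms(1), of "D - 1"] by linarith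
  have "D \<le> K * (?C + 1)"
    unfolding distrib_left using eq pos_mod_bound[OF assms(1), of "D - 1"] by linarith
  then have "D ^ 4 \<le> (K * (?C + 1)) ^ 4" using D by (intro power_mono) simp_all
  then have "D ^ 4 \<le> K ^ 4 * (?C + 1) ^ 4" by (simp add: power_mult_distrib)
  moreover have "D ^ 3 * K ^ 4 < D ^ 3 * D" using D assms(2) by (intro mult_strict_left_mono) simp_all
  ultimately have "K ^ 4 * D ^ 3 < K ^ 4 * (?C + 1) ^ 4"
    by (simp add: power4_eq_xxxx power3_eq_cube mult.commute mult.left_commute)
  then have "D ^ 3 < (?C + 1) ^ 4" using assms(1) by simp
  moreover have "D ^ n \<le> D ^ 3" using D assms(3) by (intro power_increasing) simp_all
  ultimately show "D ^ n < (?C + 1) ^ 4" by linarith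
qed

text \<open>The constant is \<open>9600 = 8 * 4 * 300\<close>: the factor 8 of
  \<open>polar_form_in_ideal\<close>, four summands, and the bound 300 on inner products of short
  vectors.\<close>

lemma universal_form_bound:
  assumes D: "D \<ge> 2" "squarefree D" and n: "n \<le> 3" and G: "gqf_Z_universal D n G"
  shows "D \<le> 9600 ^ 4"
proof (rule ccontr)
  assume "\<not> D \<le> 9600 ^ 4"
  define L where "L = {1..n} \<rightarrow> quad_int D"
  define b where "b = (\<lambda>u v. polar_form n G u (\<lambda>i. quad_conj D (u i)) v (\<lambda>i. quad_conj D (v i)))"
  define B where "B = (\<lambda>u v. \<lfloor>b u v\<rfloor>)"
  have mem: "u i \<in> quad_int D" "u i \<in> quad_field D" if "u \<in> L" "i \<in> {1..n}" for u i
    using that quad_int_subset_field[of D] by (auto simp: L_def)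
  have comb_mem: "int_comb x u y v \<in> L" if "u \<in> L" "v \<in> L" for x u y v
    unfolding L_def int_comb_def using that by (intro Pi_I quad_int_combination[OF D]) (simp_all only: mem)
  have b_comm: "b u v = b v u" for u v unfolding b_def by (rule polar_form_commute)
  have b_comb: "b (int_comb x u y v) w = of_int x * b u w + of_int y * b v w"
    if "u \<in> L" "v \<in> L" for x u y v w
    unfolding b_def polar_form_combination[symmetric] using mem that
    by (intro polar_form_cong) (simp_all add: int_comb_def quad_conj_combination[OF D])
  have b_self: "b u u = 2 * gqf_eval D n G u" for u unfolding b_def by (rule polar_form_self)
  have eval_int: "gqf_eval D n G u \<in> \<int>" if "u \<in> L" for u
    using G that by (simp add: gqf_Z_universal_def gqf_Z_valued_def L_def)
  have b_int: "b u v = of_int (B u v)" if "u \<in> L" "v \<in> L" for u v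
  proof -
    let ?w = "int_comb 1 u 1 v"
    have "2 * gqf_eval D n G ?w = b u ?w + b v ?w"
      unfolding b_self[symmetric] using that by (subst b_comb) simp_all
    also have "\<dots> = b ?w u + b ?w v" by (simp only: b_comm)
    also have "\<dots> = b u u + 2 * b u v + b v v" using that b_comm[of v u] by (simp add: b_comb)
    \<comment> \<open>Integrality of the polar form follows from that of the values at
      \<open>u\<close>, \<open>v\<close> and \<open>u + v\<close>.\<close>
    finally have "b u v = gqf_eval D n G ?w - gqf_eval D n G u - gqf_eval D n G v"
      by (simp add: b_self)
    then have "b u v \<in> \<int>" using that by (simp add: eval_int comb_mem)
    then show ?thesis by (auto simp: B_def elim: Ints_cases)
  qed
  have eval_nonneg: "gqf_eval D n G u \<ge> 0" if "u \<in> L" for u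
  proof (cases "\<exists>i\<in>{1..n}. u i \<noteq> 0")
    case True
    have "u \<in> {1..n} \<rightarrow> quad_field D" using mem that by auto
    with True G have "gqf_eval D n G u > 0"
      unfolding gqf_Z_universal_def gqf_pos_def_def by blast
    then show ?thesis by simp
  next
    case False
    have "quad_conj D 0 = 0" using quad_conj_eq[OF D, of 0 0] by simp
    with False have "gqf_eval D n G u = 0" unfolding gqf_eval_def by simp
    then show ?thesis by simp
  qed
  interpret int_form L B
  proof
    fix u v w :: "nat \<Rightarrow> real" and x y
    assume uv: "u \<in> L" "v \<in> L"
    show "int_comb x u y v \<in> L" by (rule comb_mem[OF uv])
    show "B u v = B v u" unfolding B_def by (simp only: b_comm)
    assume w: "w \<in> L"
    have "real_of_int (B (int_comb x u y v) w) = of_int (x * B u w + y * B v w)"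
      using uv w by (simp add: b_int[symmetric] comb_mem b_comb)
    then show "B (int_comb x u y v) w = x * B u w + y * B v w" by (simp only: of_int_eq_iff)
  next
    fix u assume "u \<in> L"
    then show "B u u \<ge> 0" using eval_nonneg by (simp add: B_def b_self)
  qed
  have ideal: "D dvd 8 * B w v" if "w \<in> L" "v \<in> L" "\<And>i. i \<in> {1..n} \<Longrightarrow> D dvd quad_trace D (w i)" for w v
  proof -
    have "8 * b w v \<in> sqrt_ideal D"
      unfolding b_def using D that mem G two_times_quad_int[OF D] two_times_quad_int_ideal[OF D]
      by (intro polar_form_in_ideal)
        (simp_all add: gqf_Z_universal_def gqf_integral_def coeffs_in_def)
    then have "of_int (8 * B w v) \<in> sqrt_ideal D" using b_int that by simp
    then show ?thesis by (rule int_in_sqrt_ideal[OF D])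
  qed
  obtain C where C: "C \<ge> 0" "9600 * C < D" "D ^ n < (C + 1) ^ 4"
    using exists_pigeonhole_bound[of 9600 D n] \<open>\<not> D \<le> 9600 ^ 4\<close> n by auto
  \<comment> \<open>Nonnegativity at \<open>u + v\<close> and \<open>u - v\<close> gives
    \<open>2 |B u v| <= B u u + B v v <= 600\<close>.\<close>
  have B_bound: "\<bar>B u v\<bar> \<le> 300" if "u \<in> L" "v \<in> L" "B u u \<le> 300" "B v v \<le> 300" for u v
    using B_nonneg[OF comb_mem[OF that(1,2), of 1 1]] B_nonneg[OF comb_mem[OF that(1,2), of 1 "-1"]] that
      B_commute[of v u] by simp
  have "short_dependent 300"
    unfolding short_dependent_def
  proof (intro ballI impI)
    fix u1 u2 u3 u4
    assume L: "u1 \<in> L" "u2 \<in> L" "u3 \<in> L" "u4 \<in> L"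
      and norms: "B u1 u1 \<le> 300 \<and> B u2 u2 \<le> 300 \<and> B u3 u3 \<le> 300 \<and> B u4 u4 \<le> 300"
    have "D > 0" using D by simp
    obtain c1 c2 c3 c4 where nz: "(c1, c2, c3, c4) \<noteq> (0, 0, 0, 0)"
      and c: "\<bar>c1\<bar> \<le> C" "\<bar>c2\<bar> \<le> C" "\<bar>c3\<bar> \<le> C" "\<bar>c4\<bar> \<le> C"
      and dvd: "\<forall>k\<in>{1..n}. D dvd c1 * quad_trace D (u1 k) + c2 * quad_trace D (u2 k)
          + c3 * quad_trace D (u3 k) + c4 * quad_trace D (u4 k)"
      using four_combinations_pigeonhole[OF \<open>D > 0\<close> C(1,3), of "\<lambda>k. quad_trace D (u1 k)"
          "\<lambda>k. quad_trace D (u2 k)" "\<lambda>k. quad_trace D (u3 k)" "\<lambda>k. quad_trace D (u4 k)"]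
      by blast
    define w where "w = int_comb 1 (int_comb c1 u1 c2 u2) 1 (int_comb c3 u3 c4 u4)"
    have wL: "w \<in> L" using L by (simp add: w_def)
    have w_dvd: "D dvd quad_trace D (w k)" if k: "k \<in> {1..n}" for k
    proof -
      have comb: "quad_trace D (int_comb x u y v k) = x * quad_trace D (u k) + y * quad_trace D (v k)"
        if "u \<in> L" "v \<in> L" for x u y v
        using quad_trace_combination[OF D mem(1)[OF that(1) k] mem(1)[OF that(2) k]] by (simp add: int_comb_def)
      show ?thesis using bspec[OF dvd k] L by (simp add: w_def comb add.assoc)
    qed
    have "c1 * B u1 v + c2 * B u2 v + c3 * B u3 v + c4 * B u4 v = 0"
      if v: "v \<in> {u1, u2, u3, u4}" for v
    proof -
      have vL: "v \<in> L" "B v v \<le> 300" using v L norms by auto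
      have "\<bar>c * B u v\<bar> \<le> C * 300" if "\<bar>c\<bar> \<le> C" "u \<in> L" "B u u \<le> 300" for c u
        unfolding abs_mult using that vL C(1) B_bound by (intro mult_mono) auto
      then have "\<bar>c1 * B u1 v\<bar> \<le> C * 300" "\<bar>c2 * B u2 v\<bar> \<le> C * 300"
        "\<bar>c3 * B u3 v\<bar> \<le> C * 300" "\<bar>c4 * B u4 v\<bar> \<le> C * 300"
        using c L norms by blast+
      moreover have Bw: "B w v = c1 * B u1 v + c2 * B u2 v + c3 * B u3 v + c4 * B u4 v"
        using L vL by (simp add: w_def)
      \<comment> \<open>The left side is at most \<open>8 * 4 * 300 * C = 9600 * C\<close>; a
        multiple of \<open>D\<close> this small is zero.\<close>
      ultimately have "\<bar>8 * B w v\<bar> < D" using C(2) by linarith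
      moreover have "D dvd 8 * B w v" using ideal wL vL w_dvd by blast
      ultimately have "8 * B w v = 0" using dvd_imp_le_int[of "8 * B w v" D] D(1) by linarith
      with Bw show ?thesis by simp
    qed
    with nz show "\<exists>c1 c2 c3 c4. (c1, c2, c3, c4) \<noteq> (0, 0, 0, 0) \<and>
        (\<forall>v\<in>{u1, u2, u3, u4}. c1 * B u1 v + c2 * B u2 v + c3 * B u3 v + c4 * B u4 v = 0)"
      by blast
  qed
  moreover have "\<exists>v\<in>L. B v v = 2 * m" if "m \<in> {1..115}" for m
  proof -
    have "m > 0" using that by simp
    then obtain v where "v \<in> L" "gqf_eval D n G v = of_int m"
      using G unfolding gqf_Z_universal_def L_def by blast
    then have "b v v = of_int (2 * m)" by (simp add: b_self)
    with \<open>v \<in> L\<close> show ?thesis unfolding B_def by (metis floor_of_int)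
  qed
  ultimately show False by (rule short_dependent_not_universal)
qed

theorem theorem1p4:
  shows "finite {D::int. D \<ge> 2 \<and> squarefree D \<and>
           (\<exists>n\<in>{2,3}. \<exists>G. gqf_over D n G \<and> gqf_Z_universal D n G)}"
proof (rule finite_subset)
  show "{D::int. D \<ge> 2 \<and> squarefree D \<and> (\<exists>n\<in>{2,3}. \<exists>G. gqf_over D n G \<and> gqf_Z_universal D n G)}
      \<subseteq> {2..9600 ^ 4}"
  proof
    fix D :: int
    assume "D \<in> {D. D \<ge> 2 \<and> squarefree D \<and> (\<exists>n\<in>{2,3}. \<exists>G. gqf_over D n G \<and> gqf_Z_universal D n G)}"
    then obtain n G where D: "D \<ge> 2" "squarefree D" and "n \<in> {2, 3}" and G: "gqf_Z_universal D n G"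
      by blast
    then have "n \<le> 3" by auto
    with D G show "D \<in> {2..9600 ^ 4}" using universal_form_bound by simp
  qed
qed simp

end
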